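(* For $0\le r\le n-1$, the average depth of the $r$th internal node over all increasing binary trees of size $n$ equals $$[x^rz^n]\left.\frac{\partial J(x,y,z)}{\partial y}\right|_{y=1}=H_{r+1}+H_{n-r}-2,$$ where $H_k=\sum_{i=1}^k\frac1i$ is the $k$th harmonic number and $J(x,y,z)$ is the exponential generating function in which the coefficient of $x^ry^d\frac{z^n}{n!}$ is the number of increasing binary trees of size $n$ whose $r$th internal node has depth $d$.
   Context: A binary tree here means a complete binary tree: a rooted tree where each internal (non-leaf) node has a left child and a right child (the single-node tree is allowed). An increasing binary tree of size $n$ is a binary tree with $n$ internal nodes labeled with the distinct labels $1,2,\dots,n$ in such a way that labels increase when moving away from the root (leaves are unlabeled); there are $n!$ of them. Its $n$ internal nodes are indexed $0,1,\dots,n-1$ following an inorder traversal (recursively: the internal nodes of the left subtree in inorder, then the root, then the internal nodes of the right subtree in inorder); this indexing is unrelated to the labels. The depth of a node is the number of edges in the path from the root to it. The average is over the uniform distribution. $[x^rz^n]F$ denotes the coefficient of $x^rz^n$ in the power series $F$. *)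

theory Defs
  imports
    "HOL-Library.Tree"
    "HOL-Computational_Algebra.Polynomial"
    "HOL-Computational_Algebra.Formal_Power_Series"
    "HOL-Analysis.Harmonic_Numbers"
begin

text \<open>
  Complete binary trees are the trees of \<^theory>\<open>HOL-Library.Tree\<close>: \<^const>\<open>Node\<close> is a labelled
  internal node and \<^const>\<open>Leaf\<close> an unlabelled leaf, so \<^const>\<open>size\<close> counts the internal nodes.
  The predicate \<^const>\<open>heap\<close> is the non-strict min-heap condition; since labels are distinct,
  they strictly increase away from the root.
\<close>

definition increasing_trees :: "nat \<Rightarrow> nat tree set" where
  "increasing_trees n =
     {t. size t = n \<and> distinct (inorder t) \<and> set_tree t = {1..n} \<and> heap t}"

text \<open>
  An internal node is identified with the path from the root to it, one step per edge.
\<close>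

datatype step = Go_Left | Go_Right

fun inorder_nodes :: "'a tree \<Rightarrow> step list list" where
  "inorder_nodes Leaf = []"
| "inorder_nodes (Node l a r) =
     map ((#) Go_Left) (inorder_nodes l) @ [] # map ((#) Go_Right) (inorder_nodes r)"

text \<open>Indices start at 0; the value is meaningful only for \<open>r < size t\<close>.\<close>

definition node_depth :: "'a tree \<Rightarrow> nat \<Rightarrow> nat" where
  "node_depth t r = length (inorder_nodes t ! r)"

definition average_depth :: "nat \<Rightarrow> nat \<Rightarrow> real" where
  "average_depth n r =
     (\<Sum>t\<in>increasing_trees n. real (node_depth t r)) / real (card (increasing_trees n))"

definition depth_count :: "nat \<Rightarrow> nat \<Rightarrow> nat \<Rightarrow> nat" where
  "depth_count n r d = card {t \<in> increasing_trees n. r < n \<and> node_depth t r = d}"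

text \<open>
  For fixed \<open>n\<close> only finitely many pairs \<open>(r, d)\<close> occur, so the generating function is a power
  series in \<open>z\<close> over the polynomials in \<open>x\<close> and \<open>y\<close>, and putting \<open>y = 1\<close> makes sense.
  In \<^typ>\<open>real poly poly fps\<close> the series variable is \<open>z\<close>, the outer polynomial variable is \<open>y\<close>
  and the inner one is \<open>x\<close>. The lemma \<open>J_coeff\<close> below shows that the summation bounds lose nothing.
\<close>

definition J :: "real poly poly fps" where
  "J = Abs_fps (\<lambda>n. \<Sum>r<n. \<Sum>d<n. monom (monom (real (depth_count n r d) / fact n) r) d)"

definition partial_y :: "real poly poly fps \<Rightarrow> real poly poly fps" where
  "partial_y F = Abs_fps (\<lambda>n. pderiv (fps_nth F n))"

definition at_y :: "real poly poly fps \<Rightarrow> real \<Rightarrow> real poly fps" where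
  "at_y F c = Abs_fps (\<lambda>n. poly (fps_nth F n) [:c:])"

definition coeff_xz :: "nat \<Rightarrow> nat \<Rightarrow> real poly fps \<Rightarrow> real" where
  "coeff_xz r n F = coeff (fps_nth F n) r"

lemma length_inorder_nodes [simp]: "length (inorder_nodes t) = size t"
  by (induction t) auto

lemma inorder_nodes_depth_less: "p \<in> set (inorder_nodes t) \<Longrightarrow> length p < size t"
  by (induction t arbitrary: p) fastforce+

lemma node_depth_less: "r < size t \<Longrightarrow> node_depth t r < size t"
  unfolding node_depth_def by (rule inorder_nodes_depth_less) simp

lemma depth_count_eq_0: "r \<ge> n \<or> d \<ge> n \<Longrightarrow> depth_count n r d = 0"
proof -
  assume "r \<ge> n \<or> d \<ge> n"
  then have "{t \<in> increasing_trees n. r < n \<and> node_depth t r = d} = {}"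
    by (auto simp: increasing_trees_def dest: node_depth_less)
  then show ?thesis by (simp only: depth_count_def card.empty)
qed

lemma J_coeff: "coeff (coeff (fps_nth J n) d) r = real (depth_count n r d) / fact n"
proof -
  have "coeff (coeff (fps_nth J n) d) r =
          (\<Sum>r'<n. \<Sum>d'<n. if d' = d then if r' = r then real (depth_count n r' d') / fact n else 0 else 0)"
    by (auto simp: J_def coeff_sum intro!: sum.cong)
  also have "\<dots> = (\<Sum>r'<n. if d < n then if r' = r then real (depth_count n r' d) / fact n else 0 else 0)"
    by (simp add: sum.delta)
  also have "\<dots> = (if d < n \<and> r < n then real (depth_count n r d) / fact n else 0)"
    by (cases "d < n") (simp_all add: sum.delta)
  finally show ?thesis using depth_count_eq_0[of n r d] by auto
qed

lemma finite_increasing_trees: "finite (increasing_trees n)"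
proof -
  have fin: "finite {t. size t = m \<and> set_tree t \<subseteq> {1..n}}" for m
  proof (induction m rule: less_induct)
    case (less m)
    define S where "S k = {t. size t = k \<and> set_tree t \<subseteq> {1..n}}" for k
    have "{t. size t = m \<and> set_tree t \<subseteq> {1..n}} \<subseteq>
            insert Leaf ((\<lambda>(l, a, r). Node l a r) `
              ((\<Union>k<m. S k) \<times> {1..n} \<times> (\<Union>k<m. S k)))" (is "?A \<subseteq> ?B")
    proof
      fix t assume t: "t \<in> ?A"
      show "t \<in> ?B"
      proof (cases t)
        case (Node l a r)
        with t have "l \<in> (\<Union>k<m. S k)" "a \<in> {1..n}" "r \<in> (\<Union>k<m. S k)"
          by (auto simp: S_def)
        with Node show ?thesis by force
      qed simp
    qed
    moreover have "finite (\<Union>k<m. S k)" using less by (auto simp: S_def)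
    then have "finite ?B" by (intro finite.insertI finite_imageI finite_cartesian_product) auto
    ultimately show ?case by (rule finite_subset)
  qed
  show ?thesis
    by (rule finite_subset[OF _ fin[of n]]) (auto simp: increasing_trees_def)
qed

end

theory Submission
  imports Defs
begin

text \<open>
  The root of an increasing tree carries its least label, and the remaining labels may be
  distributed over the two subtrees in any way. Hence a uniformly random increasing tree of size
  \<open>n + 1\<close> can be drawn by first drawing a left subtree size \<open>k\<close>: there are
  \<open>(n choose k) * k! * (n - k)! = n!\<close> trees for every \<open>k\<close>, so \<open>k\<close> is uniform on \<open>{0..n}\<close>, and given
  \<open>k\<close> the subtrees are, up to an order-preserving relabelling that does not affect depths,
  independent uniform increasing trees of sizes \<open>k\<close> and \<open>n - k\<close>. Passing to a subtree lowers the
  depth by one, so the averages \<open>a n r\<close> satisfy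
  \<open>(n + 1) * a (n + 1) r = (\<Sum>k. 1 + a k r) + (\<Sum>k. 1 + a (n - k) (r - k - 1))\<close>, where \<open>k\<close> runs over
  \<open>{r<..n}\<close> in the first sum (the node lies in the left subtree) and over \<open>{..<r}\<close> in the
  second. The harmonic expression solves this recurrence, by \<open>harmonic_depth_recurrence\<close>.

  Relabelling is avoided by admitting an arbitrary finite label set:
  \<open>sum_increasing_trees_on\<close> turns the decomposition at the root into a formula for sums over trees,
  which yields both the number of trees and the total depth by induction on the number of labels.
  The generating function enters only through the fact that a derivative at \<open>y = 1\<close> weights each
  depth by its frequency.
\<close>

section \<open>Harmonic sums\<close>

lemma sum_harm_upto: "(\<Sum>j=1..q. harm j) = (real q + 1) * (harm (Suc q) - 1)"
proof (induction q)
  case 0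
  show ?case by (simp add: harm_expand)
next
  case (Suc q)
  have "harm (Suc (Suc q)) = harm (Suc q) + 1 / (real q + 2)"
    by (simp add: harm_Suc[of "Suc q"] inverse_eq_divide)
  with Suc show ?case by (simp add: field_simps)
qed

definition harmonic_depth :: "nat \<Rightarrow> nat \<Rightarrow> real" where
  "harmonic_depth n r = harm (r + 1) + harm (n - r) - 2"

text \<open>
  With \<open>p = r\<close> and \<open>q = n - r\<close>, the terms with \<open>k > r\<close> contribute
  \<open>q * (harm (p + 1) - 1) + (q + 1) * (harm (q + 1) - 1)\<close>, and those with \<open>k < r\<close> contribute the
  same with \<open>p\<close> and \<open>q\<close> exchanged.
\<close>

lemma harmonic_depth_recurrence:
  assumes "r \<le> n"
  shows "(\<Sum>k\<le>n. if r < k then harmonic_depth k r + 1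
                 else if r = k then 0 else harmonic_depth (n - k) (r - k - 1) + 1)
         = (real n + 1) * harmonic_depth (n + 1) r" (is "sum ?c _ = _")
proof -
  define q where "q = n - r"
  have n: "n = r + q" using assms by (simp add: q_def)
  have "{..n} = {..<r} \<union> {r} \<union> {r<..n}" using assms by auto
  then have "sum ?c {..n} = sum ?c ({..<r} \<union> {r} \<union> {r<..n})" by simp
  also have "\<dots> = sum ?c {..<r} + sum ?c {r<..n}"
    by (subst sum.union_disjoint) (auto simp: sum.union_disjoint)
  also have "sum ?c {r<..n} = (\<Sum>j=1..q. (harm (r + 1) - 1) + harm j)"
    by (rule sum.reindex_bij_witness[where i = "\<lambda>j. j + r" and j = "\<lambda>k. k - r"])
       (auto simp: n harmonic_depth_def)
  also have "\<dots> = q * (harm (r + 1) - 1) + (real q + 1) * (harm (q + 1) - 1)"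
    by (simp add: sum.distrib sum_harm_upto[simplified])
  also have "sum ?c {..<r} = (\<Sum>j=1..r. (harm (q + 1) - 1) + harm j)"
    by (rule sum.reindex_bij_witness[where i = "\<lambda>j. r - j" and j = "\<lambda>k. r - k"])
       (auto simp: n harmonic_depth_def Suc_diff_Suc)
  also have "\<dots> = r * (harm (q + 1) - 1) + (real r + 1) * (harm (r + 1) - 1)"
    by (simp add: sum.distrib sum_harm_upto[simplified])
  finally show ?thesis
    by (simp add: n harmonic_depth_def algebra_simps)
qed

section \<open>Increasing trees on a finite set of labels\<close>

definition increasing_trees_on :: "nat set \<Rightarrow> nat tree set" where
  "increasing_trees_on A = {t. distinct (inorder t) \<and> set_tree t = A \<and> heap t}"

lemma size_increasing_trees_on: "t \<in> increasing_trees_on A \<Longrightarrow> size t = card A"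
  unfolding increasing_trees_on_def
  by (metis (mono_tags, lifting) distinct_card length_inorder mem_Collect_eq set_inorder)

lemma increasing_trees_eq: "increasing_trees n = increasing_trees_on {1..n}"
  using size_increasing_trees_on[of _ "{1..n}"]
  by (auto simp: increasing_trees_def increasing_trees_on_def)

lemma increasing_trees_on_empty: "increasing_trees_on {} = {Leaf}"
  by (auto simp: increasing_trees_on_def)

text \<open>
  The root must carry the minimum of the labels, and the label sets of the subtrees can be any two
  complementary subsets of the other labels; the left label set is recorded so that it can
  serve as a summation index.
\<close>

lemma bij_betw_increasing_trees_on:
  assumes "finite A" "A \<noteq> {}"
  defines "S \<equiv> A - {Min A}"
  shows "bij_betw (\<lambda>(B, l, r). Node l (Min A) r)
           (SIGMA B:Pow S. increasing_trees_on B \<times> increasing_trees_on (S - B))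
           (increasing_trees_on A)"
proof (rule bij_betw_byWitness[where f' = "\<lambda>t. (set_tree (left t), left t, right t)"])
  have mem: "Min A \<in> A" and le: "\<And>x. x \<in> A \<Longrightarrow> Min A \<le> x" using assms by auto
  show "(\<lambda>(B, l, r). Node l (Min A) r) `
          (SIGMA B:Pow S. increasing_trees_on B \<times> increasing_trees_on (S - B))
        \<subseteq> increasing_trees_on A"
    using mem le by (auto simp: increasing_trees_on_def S_def subset_iff)
  have root: "\<exists>l r. t = Node l (Min A) r" if "t \<in> increasing_trees_on A" for t
  proof (cases t)
    case Leaf
    with that assms show ?thesis by (auto simp: increasing_trees_on_def)
  next
    case (Node l a r)
    with that have "a \<in> A" "\<forall>x\<in>A. a \<le> x" by (auto simp: increasing_trees_on_def)
    with assms have "a = Min A" by (intro Min_eqI[symmetric]) auto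
    with Node show ?thesis by simp
  qed
  then show "\<forall>t\<in>increasing_trees_on A.
      (\<lambda>(B, l, r). Node l (Min A) r) (set_tree (left t), left t, right t) = t"
    by force
  show "(\<lambda>t. (set_tree (left t), left t, right t)) ` increasing_trees_on A
        \<subseteq> (SIGMA B:Pow S. increasing_trees_on B \<times> increasing_trees_on (S - B))"
  proof (rule image_subsetI)
    fix t assume t: "t \<in> increasing_trees_on A"
    then obtain l r where "t = Node l (Min A) r" using root by blast
    with t show "(set_tree (left t), left t, right t)
        \<in> (SIGMA B:Pow S. increasing_trees_on B \<times> increasing_trees_on (S - B))"
      by (auto simp: increasing_trees_on_def S_def)
  qed
qed (auto simp: increasing_trees_on_def)

lemma finite_increasing_trees_on: "finite A \<Longrightarrow> finite (increasing_trees_on A)"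
proof (induction A rule: finite_psubset_induct)
  case (psubset A)
  show ?case
  proof (cases "A = {}")
    case False
    with psubset.hyps have mem: "Min A \<in> A" by simp
    have "finite (SIGMA B:Pow (A - {Min A}).
            increasing_trees_on B \<times> increasing_trees_on (A - {Min A} - B))"
      using mem psubset.hyps by (intro finite_SigmaI finite_cartesian_product psubset.IH) auto
    with bij_betw_finite[OF bij_betw_increasing_trees_on[OF psubset.hyps False]]
    show ?thesis by simp
  qed (simp add: increasing_trees_on_empty)
qed

lemma sum_increasing_trees_on:
  fixes f :: "nat tree \<Rightarrow> 'a::comm_monoid_add"
  assumes "finite A" "A \<noteq> {}"
  defines "S \<equiv> A - {Min A}"
  shows "(\<Sum>t\<in>increasing_trees_on A. f t) =
    (\<Sum>B\<in>Pow S. \<Sum>l\<in>increasing_trees_on B. \<Sum>r\<in>increasing_trees_on (S - B). f (Node l (Min A) r))"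
proof -
  have fin: "finite B \<and> finite (S - B)" if "B \<in> Pow S" for B
    using that assms by (auto intro: finite_subset)
  have "(\<Sum>t\<in>increasing_trees_on A. f t) =
      (\<Sum>(B, l, r)\<in>(SIGMA B:Pow S. increasing_trees_on B \<times> increasing_trees_on (S - B)).
         f (Node l (Min A) r))"
    using sum.reindex_bij_betw[OF bij_betw_increasing_trees_on[OF assms(1,2)], of f]
    by (simp add: S_def case_prod_unfold)
  also have "\<dots> = (\<Sum>B\<in>Pow S. \<Sum>(l, r)\<in>increasing_trees_on B \<times> increasing_trees_on (S - B).
                      f (Node l (Min A) r))"
    using assms fin by (subst sum.Sigma) (auto simp: finite_increasing_trees_on)
  also have "\<dots> = (\<Sum>B\<in>Pow S. \<Sum>l\<in>increasing_trees_on B. \<Sum>r\<in>increasing_trees_on (S - B).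
                      f (Node l (Min A) r))"
    by (simp add: sum.cartesian_product)
  finally show ?thesis .
qed

section \<open>Counting trees and adding up depths\<close>

text \<open>
  The binomial coefficient that counts the subsets of size \<open>k\<close> cancels against the numbers of trees
  on the two sides, which makes every size of the left subtree equally likely.
\<close>

lemma sum_Pow_fact:
  fixes g :: "nat \<Rightarrow> real"
  assumes "finite S" "card S = n"
  shows "(\<Sum>B\<in>Pow S. fact (card B) * fact (n - card B) * g (card B)) = fact n * (\<Sum>k\<le>n. g k)"
proof -
  let ?h = "\<lambda>k. fact k * fact (n - k) * g k :: real"
  have "(\<Sum>B\<in>Pow S. ?h (card B)) = (\<Sum>k\<le>n. \<Sum>B\<in>{B \<in> Pow S. card B = k}. ?h (card B))"
    using assms by (intro sum.group[symmetric]) (auto intro: card_mono)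
  also have "\<dots> = (\<Sum>k\<le>n. real (n choose k) * ?h k)"
  proof (rule sum.cong[OF refl])
    fix k
    show "(\<Sum>B\<in>{B \<in> Pow S. card B = k}. ?h (card B)) = real (n choose k) * ?h k"
      using n_subsets[OF assms(1), of k] assms(2) by simp
  qed
  also have "\<dots> = (\<Sum>k\<le>n. fact n * g k)"
    by (intro sum.cong refl) (simp add: binomial_fact)
  finally show ?thesis by (simp add: sum_distrib_left)
qed

lemma card_increasing_trees_on: "finite A \<Longrightarrow> real (card (increasing_trees_on A)) = fact (card A)"
proof (induction A rule: finite_psubset_induct)
  case (psubset A)
  show ?case
  proof (cases "A = {}")
    case False
    define S where "S = A - {Min A}"
    from False psubset.hyps have mem: "Min A \<in> A" by simp
    obtain n where n: "card A = Suc n" using False psubset.hyps by (cases "card A") auto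
    have S: "finite S" "card S = n" using mem psubset.hyps n by (auto simp: S_def)
    have IH: "real (card (increasing_trees_on B)) = fact (card B)" if "B \<subseteq> S" for B
      using that mem by (intro psubset.IH) (auto simp: S_def)
    have "real (card (increasing_trees_on A)) =
        (\<Sum>B\<in>Pow S. real (card (increasing_trees_on B)) * real (card (increasing_trees_on (S - B))))"
      using sum_increasing_trees_on[OF psubset.hyps False, of "\<lambda>_. 1 :: real"]
      by (simp add: S_def)
    also have "\<dots> = (\<Sum>B\<in>Pow S. fact (card B) * fact (n - card B) * 1)"
      using S by (intro sum.cong refl) (auto simp: IH card_Diff_subset finite_subset)
    also have "\<dots> = fact n * (\<Sum>k\<le>n. 1)" by (rule sum_Pow_fact[OF S])
    finally show ?thesis by (simp add: n)
  qed (simp add: increasing_trees_on_empty)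
qed

lemma node_depth_Node:
  assumes "i \<le> size l + size r"
  shows "node_depth (Node l a r) i =
    (if i < size l then node_depth l i + 1
     else if i = size l then 0 else node_depth r (i - size l - 1) + 1)"
  using assms by (auto simp: node_depth_def nth_append nth_Cons')

text \<open>
  Conditioning on the size of the left subtree gives the recurrence of
  \<open>harmonic_depth_recurrence\<close>, scaled by the number of trees; totals instead of averages
  keep divisions out of the induction.
\<close>

lemma sum_node_depth_increasing_trees_on:
  assumes "finite A" "i < card A"
  shows "(\<Sum>t\<in>increasing_trees_on A. real (node_depth t i)) =
         fact (card A) * harmonic_depth (card A) i"
  using assms
proof (induction A arbitrary: i rule: finite_psubset_induct)
  case (psubset A)
  let ?d = "\<lambda>t i. real (node_depth t i)"
  let ?T = increasing_trees_on
  define S where "S = A - {Min A}"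
  obtain n where n: "card A = Suc n" using psubset.prems by (cases "card A") auto
  then have ne: "A \<noteq> {}" by auto
  with psubset.hyps have mem: "Min A \<in> A" by simp
  have S: "finite S" "card S = n" using mem psubset.hyps n by (auto simp: S_def)
  have IH: "(\<Sum>t\<in>?T B. ?d t j) = fact (card B) * harmonic_depth (card B) j"
    if "B \<subseteq> S" "j < card B" for B j
    using that mem by (intro psubset.IH) (auto simp: S_def)
  have i: "i \<le> n" using psubset.prems n by simp
  \<comment> \<open>the average depth of node \<open>i\<close> among the trees whose left subtree has size \<open>k\<close>\<close>
  define g where "g k = (if i < k then harmonic_depth k i + 1
      else if i = k then 0 else harmonic_depth (n - k) (i - k - 1) + 1)" for k
  have inner: "(\<Sum>l\<in>?T B. \<Sum>r\<in>?T (S - B). ?d (Node l (Min A) r) i) =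
      fact (card B) * fact (n - card B) * g (card B)" if B: "B \<subseteq> S" for B
  proof -
    let ?k = "card B"
    have fin: "finite B" "finite (S - B)" using B S finite_subset by auto
    have k: "?k \<le> n" "card (S - B) = n - ?k"
      using B S fin by (auto simp: card_Diff_subset intro: card_mono)
    have cards: "real (card (?T B)) = fact ?k" "real (card (?T (S - B))) = fact (n - ?k)"
      using card_increasing_trees_on fin k by simp_all
    have "(\<Sum>l\<in>?T B. \<Sum>r\<in>?T (S - B). ?d (Node l (Min A) r) i) =
        (\<Sum>l\<in>?T B. \<Sum>r\<in>?T (S - B). if i < ?k then ?d l i + 1
           else if i = ?k then 0 else ?d r (i - ?k - 1) + 1)"
      using i k by (intro sum.cong refl)
        (auto simp: node_depth_Node size_increasing_trees_on)
    also have "\<dots> = fact ?k * fact (n - ?k) * g ?k"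
    proof (cases i ?k rule: linorder_cases)
      case less
      then show ?thesis
        by (simp add: g_def IH[OF B] sum.distrib cards sum_distrib_right[symmetric] algebra_simps)
    next
      case equal
      then show ?thesis by (simp add: g_def)
    next
      case greater
      then have "(\<Sum>r\<in>?T (S - B). ?d r (i - ?k - 1)) =
          fact (n - ?k) * harmonic_depth (n - ?k) (i - ?k - 1)"
        using IH[of "S - B" "i - ?k - 1"] i k by auto
      with greater show ?thesis
        by (simp add: g_def sum.distrib cards algebra_simps)
    qed
    finally show ?thesis .
  qed
  have "(\<Sum>t\<in>?T A. ?d t i) = (\<Sum>B\<in>Pow S. fact (card B) * fact (n - card B) * g (card B))"
    unfolding sum_increasing_trees_on[OF psubset.hyps ne] S_def[symmetric]
    by (intro sum.cong refl inner) auto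
  also have "\<dots> = fact n * (\<Sum>k\<le>n. g k)" by (rule sum_Pow_fact[OF S])
  also have "\<dots> = fact n * ((real n + 1) * harmonic_depth (n + 1) i)"
    unfolding g_def by (simp only: harmonic_depth_recurrence[OF i])
  finally show ?case by (simp add: n algebra_simps)
qed

lemma average_depth_eq_harmonic_depth:
  assumes "r < n"
  shows "average_depth n r = harmonic_depth n r"
  using assms sum_node_depth_increasing_trees_on[of "{1..n}" r] card_increasing_trees_on[of "{1..n}"]
  by (simp add: average_depth_def increasing_trees_eq)

section \<open>The derivative of the generating function\<close>

text \<open>
  Differentiating \<open>y ^ d\<close> and putting \<open>y = 1\<close> leaves the factor \<open>d\<close>, so the coefficient is the
  total depth, grouped by depth, over the \<open>n!\<close> of the exponential generating function. As \<open>n!\<close>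
  is also the number of trees, this is an average.
\<close>

lemma coeff_xz_partial_y_J:
  assumes "r < n"
  shows "coeff_xz r n (at_y (partial_y J) 1) = (\<Sum>d<n. real d * real (depth_count n r d)) / fact n"
proof -
  have one: "[:1:] = (1 :: real poly)" by (simp add: one_pCons)
  have "coeff_xz r n (at_y (partial_y J) 1) =
      (\<Sum>r'<n. \<Sum>d<n. if r' = r then real d * real (depth_count n r' d) / fact n else 0)"
    unfolding coeff_xz_def at_y_def partial_y_def J_def one
    by (auto simp: higher_pderiv_sum[of 1, simplified] pderiv_monom poly_sum poly_monom coeff_sum of_nat_poly
             intro!: sum.cong)
  also have "\<dots> = (\<Sum>r'<n. if r' = r then \<Sum>d<n. real d * real (depth_count n r' d) / fact n else 0)"
    by (intro sum.cong) auto
  also have "\<dots> = (\<Sum>d<n. real d * real (depth_count n r d) / fact n)"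
    using assms by simp
  finally show ?thesis by (simp add: sum_divide_distrib)
qed

lemma sum_depth_count:
  assumes "r < n"
  shows "(\<Sum>d<n. real d * real (depth_count n r d)) =
         (\<Sum>t\<in>increasing_trees n. real (node_depth t r))"
proof -
  have "(\<Sum>t\<in>increasing_trees n. real (node_depth t r)) =
      (\<Sum>d<n. \<Sum>t\<in>{t \<in> increasing_trees n. node_depth t r = d}. real (node_depth t r))"
    using assms
    by (intro sum.group[symmetric] finite_increasing_trees)
       (auto simp: increasing_trees_def dest: node_depth_less)
  also have "\<dots> = (\<Sum>d<n. real d * real (depth_count n r d))"
    using assms by (intro sum.cong) (auto simp: depth_count_def)
  finally show ?thesis by simp
qed

theorem theorem7p4:
  fixes n r :: nat
  assumes "r < n"
  shows "average_depth n r = coeff_xz r n (at_y (partial_y J) 1) \<and>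
         coeff_xz r n (at_y (partial_y J) 1) = harm (r + 1) + harm (n - r) - 2"
proof -
  have "real (card (increasing_trees n)) = fact n"
    by (simp add: increasing_trees_eq card_increasing_trees_on)
  then have "coeff_xz r n (at_y (partial_y J) 1) = average_depth n r"
    by (simp add: coeff_xz_partial_y_J[OF assms] sum_depth_count[OF assms] average_depth_def)
  with average_depth_eq_harmonic_depth[OF assms] show ?thesis
    by (simp add: harmonic_depth_def)
qed

end
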